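(* Let $t\ge 2$ be an integer and let $\kappa\ge 1$ be a real number. For positive integers $r,s$ let $P^t_{r,s}$ be the number of $t$-cores $\lambda$ with $\ell(\lambda)\le r$ and $\lambda_1\le s$. As $r,s\to\infty$ such that $s/r\to\kappa$, $$\lim_{r,s\to\infty}\frac{P^t_{r,s}}{r^{t-1}}=\frac{A(t,\kappa)}{t^{t-1}},$$ where $$A(t,\kappa)=\frac{1}{(t-1)!}\sum_{j=0}^{\left\lfloor \frac{t}{\kappa+1}\right\rfloor}(-1)^j\binom{t}{j}\bigl(t-(1+\kappa)j\bigr)^{t-1}.$$
   Context: A partition $\lambda=(\lambda_1\ge\lambda_2\ge\cdots)$ is a weakly decreasing finite sequence of positive integers (possibly empty); $\ell(\lambda)$ is its number of parts, and $\lambda_1=0$ if $\lambda$ is empty. A rim-hook of $\lambda$ is a connected skew shape $\lambda/\mu$ (with $\mu\subseteq\lambda$ a partition) containing no $2\times 2$ block of boxes; a $t$-rim hook is a rim-hook with exactly $t$ boxes. A partition is a $t$-core if no $t$-rim hook can be removed from it so as to leave the Young diagram of a partition. The limit means: for all sequences of positive integers $(r_k),(s_k)$ with $r_k\to\infty$, $s_k\to\infty$ and $s_k/r_k\to\kappa$, the quantity $P^t_{r_k,s_k}/r_k^{t-1}$ converges to the stated value. *)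

theory Defs
  imports Complex_Main
begin

definition is_partition :: "nat list \<Rightarrow> bool" where
  "is_partition \<alpha> \<longleftrightarrow> sorted_wrt (\<ge>) \<alpha> \<and> (\<forall>p\<in>set \<alpha>. 0 < p)"

definition largest_part :: "nat list \<Rightarrow> nat" where
  "largest_part \<alpha> = (case \<alpha> of [] \<Rightarrow> 0 | p # _ \<Rightarrow> p)"

text \<open>Boxes are pairs (row, column), both counted from 0.\<close>

definition young_diagram :: "nat list \<Rightarrow> (nat \<times> nat) set" where
  "young_diagram \<alpha> = {(i, j). i < length \<alpha> \<and> j < \<alpha> ! i}"

text \<open>Two boxes are adjacent if they share an edge; sharing only a corner does not count.\<close>

definition adjacent :: "nat \<times> nat \<Rightarrow> nat \<times> nat \<Rightarrow> bool" where
  "adjacent a b \<longleftrightarrow>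
     (fst a = fst b \<and> (snd b = Suc (snd a) \<or> snd a = Suc (snd b))) \<or>
     (snd a = snd b \<and> (fst b = Suc (fst a) \<or> fst a = Suc (fst b)))"

definition connected_boxes :: "(nat \<times> nat) set \<Rightarrow> bool" where
  "connected_boxes S \<longleftrightarrow>
     (\<forall>a\<in>S. \<forall>b\<in>S. (a, b) \<in> {(x, y). x \<in> S \<and> y \<in> S \<and> adjacent x y}\<^sup>*)"

definition has_2x2_block :: "(nat \<times> nat) set \<Rightarrow> bool" where
  "has_2x2_block S \<longleftrightarrow>
     (\<exists>i j. {(i, j), (i, Suc j), (Suc i, j), (Suc i, Suc j)} \<subseteq> S)"

text \<open>The skew shape \<open>\<alpha>/\<mu>\<close> is the set of boxes of \<open>\<alpha>\<close> outside \<open>\<mu>\<close>. With this definition the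
  empty skew shape is a rim hook too; it has 0 boxes, so it is not a \<open>t\<close>-rim hook for \<open>t > 0\<close>.\<close>

definition is_rim_hook :: "nat list \<Rightarrow> nat list \<Rightarrow> bool" where
  "is_rim_hook \<alpha> \<mu> \<longleftrightarrow>
     is_partition \<mu> \<and> young_diagram \<mu> \<subseteq> young_diagram \<alpha> \<and>
     connected_boxes (young_diagram \<alpha> - young_diagram \<mu>) \<and>
     \<not> has_2x2_block (young_diagram \<alpha> - young_diagram \<mu>)"

definition is_t_rim_hook :: "nat \<Rightarrow> nat list \<Rightarrow> nat list \<Rightarrow> bool" where
  "is_t_rim_hook t \<alpha> \<mu> \<longleftrightarrow>
     is_rim_hook \<alpha> \<mu> \<and> card (young_diagram \<alpha> - young_diagram \<mu>) = t"

definition is_t_core :: "nat \<Rightarrow> nat list \<Rightarrow> bool" where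
  "is_t_core t \<alpha> \<longleftrightarrow> is_partition \<alpha> \<and> (\<nexists>\<mu>. is_t_rim_hook t \<alpha> \<mu>)"

definition num_t_cores :: "nat \<Rightarrow> nat \<Rightarrow> nat \<Rightarrow> nat" where
  "num_t_cores t r s = card {\<alpha>. is_t_core t \<alpha> \<and> length \<alpha> \<le> r \<and> largest_part \<alpha> \<le> s}"

definition limit_A :: "nat \<Rightarrow> real \<Rightarrow> real" where
  "limit_A t \<kappa> = 1 / fact (t - 1) *
     (\<Sum>j = 0..nat \<lfloor>real t / (\<kappa> + 1)\<rfloor>.
        (-1) ^ j * real (t choose j) * (real t - (1 + \<kappa>) * real j) ^ (t - 1))"

end

theory Submission
  imports Defs "HOL-Computational_Algebra.Formal_Power_Series"
begin

text \<open>Encode a partition \<open>\<lambda>\<close> by its beads \<open>\<lambda>\<^sub>i - i\<close>. Removing a \<open>t\<close>-rim hook amounts to moving a bead from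
  \<open>z\<close> to an unoccupied position \<open>z - t\<close>, so \<open>\<lambda>\<close> is a \<open>t\<close>-core iff its set of beads is closed under
  subtracting \<open>t\<close>. On the abacus with \<open>t\<close> runners the \<open>t\<close>-cores in an \<open>r \<times> s\<close> box thus correspond to
  the ways of distributing \<open>r\<close> beads over the runners, where each runner takes at most about
  \<open>(r + s) / t\<close> of them. The number of such bounded compositions is a coefficient of
  \<open>((1 - X\<^sup>m) / (1 - X))\<^sup>t\<close>, an alternating sum of binomial coefficients, and the limit is taken
  term by term.\<close>

subsection \<open>Rim hooks and beads\<close>

text \<open>Padding with zeros turns a partition into a total function, so a skew shape is the
  region between two functions and rows past the end need no separate treatment.\<close>

definition row :: "nat list \<Rightarrow> nat \<Rightarrow> nat" where
  "row \<alpha> i = (if i < length \<alpha> then \<alpha> ! i else 0)"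

lemma young_diagram_row: "young_diagram \<alpha> = {(i, j). j < row \<alpha> i}"
  by (auto simp: young_diagram_def row_def split: if_splits)

lemma antimono_row:
  assumes "is_partition \<alpha>"
  shows "antimono (row \<alpha>)"
proof
  fix i j :: nat
  assume "i \<le> j"
  then consider "i = j" | "i < j" "j < length \<alpha>" | "length \<alpha> \<le> j" by linarith
  then show "row \<alpha> j \<le> row \<alpha> i"
    using assms by cases (simp_all add: is_partition_def sorted_wrt_iff_nth_less row_def)
qed

text \<open>Positivity of the parts makes the length the first zero of \<open>row\<close>. This lets
  \<open>row\<close> determine the list in \<open>row_inject\<close>.\<close>

lemma length_le_iff_row: "is_partition \<alpha> \<Longrightarrow> length \<alpha> \<le> n \<longleftrightarrow> row \<alpha> n = 0"
  by (cases "n < length \<alpha>") (auto simp: is_partition_def row_def dest!: nth_mem)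

lemma row_eq_0: "length \<alpha> \<le> i \<Longrightarrow> row \<alpha> i = 0"
  by (simp add: row_def)

lemma largest_part_row: "largest_part \<alpha> = row \<alpha> 0"
  by (auto simp: largest_part_def row_def split: list.split)

lemma row_inject:
  assumes "is_partition \<alpha>" "is_partition \<beta>" "row \<alpha> = row \<beta>"
  shows "\<alpha> = \<beta>"
proof (rule nth_equalityI)
  show len: "length \<alpha> = length \<beta>"
    using length_le_iff_row[OF assms(1), of "length \<beta>"] length_le_iff_row[OF assms(2), of "length \<alpha>"]
      assms(3) row_eq_0[OF order.refl, of \<alpha>] row_eq_0[OF order.refl, of \<beta>] by simp
  show "\<alpha> ! i = \<beta> ! i" if "i < length \<alpha>" for i
    using fun_cong[OF assms(3), of i] that len by (simp add: row_def)
qed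

lemma ex_partition_row:
  assumes "antimono f" "f n = 0"
  obtains \<beta> where "is_partition \<beta>" "row \<beta> = f"
proof
  define m where "m = (LEAST m. f m = 0)"
  have m0: "f m = 0" unfolding m_def using assms(2) by (rule LeastI)
  have pos: "f i > 0" if "i < m" for i
    using not_less_Least[of i "\<lambda>m. f m = 0"] that unfolding m_def by auto
  have zero: "f i = 0" if "m \<le> i" for i
    using antimonoD[OF assms(1) that] m0 by simp
  show "is_partition (map f [0..<m])"
    unfolding is_partition_def sorted_wrt_iff_nth_less
    using antimonoD[OF assms(1)] pos by simp
  show "row (map f [0..<m]) = f"
    by (rule ext) (simp add: row_def zero)
qed

text \<open>This is the Maya diagram of the partition. Empty rows contribute beads as well, so all
  sufficiently negative integers are occupied.\<close>

definition beads :: "nat list \<Rightarrow> int set" where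
  "beads \<alpha> = range (\<lambda>i. int (row \<alpha> i) - int i)"

section \<open>Border strips between two row functions\<close>

text \<open>The link condition says that \<open>u (Suc i) - Suc i\<close> equals
  \<open>v i - i\<close> over the integers, so the sum of the row differences telescopes to the bead
  of \<open>u\<close> in row \<open>a\<close> minus the bead of \<open>v\<close> in row
  \<open>b\<close>.\<close>

lemma sum_border_strip:
  fixes u v :: "nat \<Rightarrow> nat"
  assumes "a \<le> b" "\<And>i. a \<le> i \<Longrightarrow> i \<le> b \<Longrightarrow> v i \<le> u i"
    and "\<And>i. a \<le> i \<Longrightarrow> i < b \<Longrightarrow> u (Suc i) = Suc (v i)"
  shows "int (\<Sum>i=a..b. u i - v i) = int (u a) - int (v b) + int b - int a"
  using assms
proof (induction b rule: dec_induct)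
  case base
  then show ?case by (simp add: of_nat_diff)
next
  case (step n)
  have "int (\<Sum>i=a..n. u i - v i) = int (u a) - int (v n) + int n - int a"
    using step by auto
  moreover have "u (Suc n) = Suc (v n)" using step by simp
  moreover have "v (Suc n) \<le> u (Suc n)" using step.prems(1)[of "Suc n"] step.hyps by simp
  ultimately show ?case using step.hyps by simp
qed

lemma card_skew_shape:
  fixes u v :: "nat \<Rightarrow> nat"
  assumes "\<And>i. i \<notin> {a..b} \<Longrightarrow> v i = u i"
  shows "card {(i, j). v i \<le> j \<and> j < u i} = (\<Sum>i=a..b. u i - v i)"
proof -
  have "i \<in> {a..b}" if "v i \<le> j" "j < u i" for i j
    using assms[of i] that by (cases "i \<in> {a..b}") simp_all
  then have "{(i, j). v i \<le> j \<and> j < u i} = Sigma {a..b} (\<lambda>i. {v i..<u i})"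
    by auto
  then show ?thesis by simp
qed

text \<open>Each row is an interval of boxes, and by the link condition the leftmost box
  \<open>(i, v i)\<close> of row \<open>i\<close> stands directly above the rightmost box of row
  \<open>Suc i\<close>. Hence every box is reachable from \<open>(a, v a)\<close>.\<close>

lemma connected_skew_shape:
  fixes u v :: "nat \<Rightarrow> nat"
  defines "S \<equiv> {(i, j). v i \<le> j \<and> j < u i}"
  assumes "\<And>i. i \<notin> {a..b} \<Longrightarrow> v i = u i"
    and "\<And>i. a \<le> i \<Longrightarrow> i < b \<Longrightarrow> u (Suc i) = Suc (v i)"
    and "\<And>i. a \<le> i \<Longrightarrow> i \<le> b \<Longrightarrow> v i < u i"
  shows "connected_boxes S"
proof -
  define R where "R = {(x, y). x \<in> S \<and> y \<in> S \<and> adjacent x y}"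
  have "sym R" unfolding R_def sym_def adjacent_def by auto
  then have symR: "(x, y) \<in> R\<^sup>* \<Longrightarrow> (y, x) \<in> R\<^sup>*" for x y
    using sym_rtrancl symD by metis
  have le: "((i, j), (i, j')) \<in> R\<^sup>*" if "j \<le> j'" "(i, j) \<in> S" "(i, j') \<in> S" for i j j'
    using that
  proof (induction j' rule: dec_induct)
    case (step n)
    then have "((i, n), (i, Suc n)) \<in> R" by (auto simp: R_def S_def adjacent_def)
    moreover have "((i, j), (i, n)) \<in> R\<^sup>*" using step by (auto simp: S_def)
    ultimately show ?case by (rule rtrancl_into_rtrancl[rotated])
  qed simp
  have same: "((i, j), (i, j')) \<in> R\<^sup>*" if "(i, j) \<in> S" "(i, j') \<in> S" for i j j'
    using le[of j j' i] le[of j' j i] symR that by (metis nat_le_linear)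
  have main: "\<forall>j. (i, j) \<in> S \<longrightarrow> ((a, v a), (i, j)) \<in> R\<^sup>*" if "a \<le> i" "i \<le> b" for i
    using that
  proof (induction i rule: dec_induct)
    case base
    then show ?case using same assms(4)[of a] by (auto simp: S_def)
  next
    case (step n)
    have u: "u (Suc n) = Suc (v n)" "v (Suc n) < u (Suc n)" "v n < u n"
      using step.hyps step.prems assms(3)[of n] assms(4)[of n] assms(4)[of "Suc n"] by simp_all
    then have "((n, v n), (Suc n, v n)) \<in> R" "(n, v n) \<in> S" and s: "(Suc n, v n) \<in> S"
      by (auto simp: R_def S_def adjacent_def)
    then have "((a, v a), (Suc n, v n)) \<in> R\<^sup>*" 
      using step by (meson Suc_leD rtrancl_into_rtrancl)
    then show ?case using same[OF s] by (meson rtrancl_trans)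
  qed
  have all: "((a, v a), x) \<in> R\<^sup>*" if "x \<in> S" for x
  proof -
    have "fst x \<in> {a..b}" using that assms(2)[of "fst x"] by (force simp: S_def)
    then show ?thesis using main[of "fst x"] that by (cases x) auto
  qed
  have "(x, y) \<in> R\<^sup>*" if "x \<in> S" "y \<in> S" for x y
    using rtrancl_trans[OF symR[OF all[OF that(1)]] all[OF that(2)]] .
  then show ?thesis unfolding connected_boxes_def R_def by blast
qed

text \<open>A path from row \<open>a\<close> to row \<open>b\<close> changes the row by at most one
  per step, so it must somewhere step vertically from row \<open>i\<close> to row
  \<open>Suc i\<close>. Without a shared column it would stay in rows up to
  \<open>i\<close>.\<close>

lemma connected_overlap:
  fixes u v :: "nat \<Rightarrow> nat"
  defines "S \<equiv> {(i, j). v i \<le> j \<and> j < u i}"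
  assumes "connected_boxes S" "(a, j) \<in> S" "(b, k) \<in> S" "a \<le> i" "i < b"
  obtains c where "(i, c) \<in> S" "(Suc i, c) \<in> S"
proof -
  have "\<exists>c. (i, c) \<in> S \<and> (Suc i, c) \<in> S"
  proof (rule ccontr)
    assume none: "\<not> ?thesis"
    have "((a, j), (b, k)) \<in> {(x, y). x \<in> S \<and> y \<in> S \<and> adjacent x y}\<^sup>*"
      using assms by (auto simp: connected_boxes_def)
    then have "fst (b, k) \<le> i"
    proof (induction rule: rtrancl_induct)
      case base
      then show ?case using assms by simp
    next
      case (step y z)
      show ?case
      proof (rule ccontr)
        assume "\<not> fst z \<le> i"
        then have "fst y = i" "fst z = Suc i" "snd y = snd z"
          using step by (auto simp: adjacent_def)
        then show False using none step by (metis (mono_tags, lifting) case_prodD mem_Collect_eq prod.collapse)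
      qed
    qed
    then show False using assms by simp
  qed
  then show thesis using that by blast
qed

lemma skew_shape_row:
  "young_diagram \<alpha> - young_diagram \<mu> = {(i, j). row \<mu> i \<le> j \<and> j < row \<alpha> i}"
  by (auto simp: young_diagram_row)

lemma young_diagram_subset_iff:
  "young_diagram \<mu> \<subseteq> young_diagram \<alpha> \<longleftrightarrow> (\<forall>i. row \<mu> i \<le> row \<alpha> i)"
  unfolding young_diagram_row subset_iff by (auto intro: less_le_trans) (meson leI less_irrefl)

text \<open>If the hook occupies rows \<open>a\<close> to \<open>b\<close>, the witness is the bead
  of row \<open>a\<close>: lowered by \<open>t\<close>, it lands on the bead of row \<open>b\<close>
  of \<mu>, which falls in a gap between beads of \<alpha>.\<close>

lemma rim_hook_bead:
  assumes "t > 0" "is_partition \<alpha>" "is_t_rim_hook t \<alpha> \<mu>"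
  shows "\<exists>z\<in>beads \<alpha>. z - int t \<notin> beads \<alpha>"
proof -
  define u v where "u = row \<alpha>" and "v = row \<mu>"
  define S where "S = {(i, j). v i \<le> j \<and> j < u i}"
  have S: "young_diagram \<alpha> - young_diagram \<mu> = S"
    by (simp add: S_def u_def v_def skew_shape_row)
  have h: "is_partition \<mu>" "\<And>i. v i \<le> u i" "connected_boxes S" "\<not> has_2x2_block S" "card S = t"
    using assms(3) unfolding is_t_rim_hook_def is_rim_hook_def S young_diagram_subset_iff
    by (auto simp: u_def v_def)
  have anti: "antimono u" "antimono v" 
    using antimono_row assms(2) h(1) by (auto simp: u_def v_def)
  define I where "I = {i. v i < u i}"
  have "I \<subseteq> {..<length \<alpha>}" by (auto simp: I_def u_def row_def split: if_splits)
  then have finI: "finite I" by (rule finite_subset) simp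
  have "S \<noteq> {}" using h(5) assms(1) by auto
  then have neI: "I \<noteq> {}" by (auto simp: I_def S_def dest: le_less_trans)
  define a b where "a = Min I" and "b = Max I"
  have ab: "a \<in> I" "b \<in> I" "a \<le> b" "\<And>i. i \<in> I \<Longrightarrow> a \<le> i \<and> i \<le> b"
    using finI neI by (auto simp: a_def b_def)
  have out: "v i = u i" if "i \<notin> {a..b}" for i
    using ab(4)[of i] that h(2)[of i] by (force simp: I_def)
  \<comment> \<open>Connectedness forces rows \<open>i\<close> and \<open>Suc i\<close> to share a
    column, and the absence of a 2x2 block forbids two shared columns. The overlap is therefore
    exactly one box.\<close>
  have link: "u (Suc i) = Suc (v i)" if "a \<le> i" "i < b" for i
  proof -
    have "(a, v a) \<in> S" "(b, v b) \<in> S" using ab(1,2) by (simp_all add: S_def I_def)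
    from connected_overlap[OF h(3)[unfolded S_def] this[unfolded S_def] that, folded S_def]
    obtain c where c: "(i, c) \<in> S" "(Suc i, c) \<in> S" .
    have dec: "u (Suc i) \<le> u i" "v (Suc i) \<le> v i"
      using anti by (auto simp: antimono_def)
    have "\<not> Suc (v i) < u (Suc i)"
    proof
      assume "Suc (v i) < u (Suc i)"
      then have "{(i, v i), (i, Suc (v i)), (Suc i, v i), (Suc i, Suc (v i))} \<subseteq> S"
        using dec by (auto simp: S_def)
      then show False using h(4) unfolding has_2x2_block_def by blast
    qed
    then show ?thesis using c by (auto simp: S_def)
  qed
  have "int t = int (u a) - int (v b) + int b - int a"
    using sum_border_strip[of a b v u, OF ab(3) h(2) link] card_skew_shape[of a b v u, OF out] h(5)
    unfolding S_def by linarith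
  then have eq: "int (u a) - int a - int t = int (v b) - int b" by simp
  \<comment> \<open>Rows up to \<open>b\<close> have strictly larger beads because
    \<open>v b < u b\<close>. Rows below \<open>b\<close> agree with \<mu>, whose beads strictly
    decrease, so their beads are strictly smaller.\<close>
  have "int (v b) - int b \<noteq> int (u i) - int i" for i
  proof (cases "i \<le> b")
    case True
    then have "u b \<le> u i" using anti by (auto simp: antimono_def)
    moreover have "v b < u b" using ab by (auto simp: I_def)
    ultimately show ?thesis using True by linarith
  next
    case False
    then have "v i \<le> v b" using anti by (auto simp: antimono_def)
    moreover have "v i = u i" using out[of i] False by auto
    ultimately show ?thesis using False by linarith
  qed
  then have "int (u a) - int a - int t \<notin> beads \<alpha>"
    unfolding eq by (auto simp: beads_def u_def)
  then show ?thesis unfolding beads_def u_def by blast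
qed

text \<open>Conversely, moving the bead \<open>z\<close> of row \<open>a\<close> to the free
  position \<open>z - t\<close> and sorting the beads again yields the rows of \<mu>.\<close>

lemma bead_rim_hook:
  assumes "t > 0" "is_partition \<alpha>" "z \<in> beads \<alpha>" "z - int t \<notin> beads \<alpha>"
  shows "\<exists>\<mu>. is_t_rim_hook t \<alpha> \<mu>"
proof -
  define u where "u = row \<alpha>"
  have anti: "antimono u" using antimono_row assms(2) by (auto simp: u_def)
  have dec: "u j \<le> u i" if "i \<le> j" for i j using anti that by (auto simp: antimono_def)
  obtain a where a: "z = int (u a) - int a" using assms(3) by (auto simp: beads_def u_def)
  \<comment> \<open>The rows whose beads lie above the free position; the last of them,
    \<open>b\<close>, is the row in which the moved bead ends up.\<close>
  define J where "J = {i. int (u i) - int i > z - int t}"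
  have "J \<subseteq> {..nat (int (u 0) - z + int t)}"
  proof
    fix i assume "i \<in> J"
    then show "i \<in> {..nat (int (u 0) - z + int t)}"
      using dec[of 0 i] by (auto simp: J_def)
  qed
  then have finJ: "finite J" by (rule finite_subset) simp
  have aJ: "a \<in> J" using assms(1) by (auto simp: J_def a)
  define b where "b = Max J"
  have bJ: "b \<in> J" "a \<le> b" using finJ aJ Max_in[OF finJ] Max_ge[OF finJ aJ] unfolding b_def by blast+
  have "Suc b \<notin> J" using Max_ge[OF finJ, of "Suc b"] unfolding b_def[symmetric] by auto
  \<comment> \<open>As \<open>z - t\<close> is free, the inequality given by
    \<open>Suc b \<notin> J\<close> is strict. This gains the unit needed for
    \<open>u (Suc b) \<le> w\<close>, and it also keeps \<open>nat\<close> from truncating in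
    \<open>w\<close>.\<close>
  moreover have "z - int t \<noteq> int (u (Suc b)) - int (Suc b)"
  proof
    assume "z - int t = int (u (Suc b)) - int (Suc b)"
    then have "z - int t \<in> beads \<alpha>" unfolding beads_def u_def by (rule range_eqI)
    then show False using assms(4) by contradiction
  qed
  ultimately have lo: "int (u (Suc b)) - int b \<le> z - int t" by (auto simp: J_def)
  define w where "w = nat (z - int t + int b)"
  have w: "int w = z - int t + int b" "u (Suc b) \<le> w" "w < u b"
    using lo bJ(1) by (auto simp: w_def J_def)
  \<comment> \<open>Removing the bead of row \<open>a\<close> moves the beads of rows
    \<open>Suc a\<close> to \<open>b\<close> one index up. Keeping such a bead in place while its
    index drops by one shortens the row by one. Row \<open>b\<close> receives the moved
    bead.\<close>
  define v where "v i = (if a \<le> i \<and> i < b then u (Suc i) - 1 else if i = b then w else u i)" for i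
  \<comment> \<open>Guarantees that the natural subtraction in \<open>v\<close> does not
    truncate.\<close>
  have pos: "0 < u (Suc i)" if "i < b" for i
    using dec[of "Suc i" b] that w(3) by linarith
  have vu: "v i \<le> u i" for i
    using dec[of i "Suc i"] w(3) by (auto simp: v_def)
  have vuS: "u (Suc i) \<le> Suc (v i)" if "i < b" for i
    using that dec[of i "Suc i"] by (auto simp: v_def)
  have "v (Suc i) \<le> v i" for i
  proof -
    consider "Suc i < a" | "Suc i = a" | "a \<le> i" "Suc i < b" | "a \<le> i" "Suc i = b" | "i = b" | "i > b"
      using bJ(2) by linarith
    then show ?thesis
    proof cases
      case 3
      then have "u (Suc (Suc i)) - 1 \<le> u (Suc i) - 1"
        using dec[of "Suc i" "Suc (Suc i)"] by linarith
      then show ?thesis using 3 by (simp add: v_def)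
    next
      case 2
      then have "v i = u i" using bJ(2) by (simp add: v_def)
      then show ?thesis using vu[of "Suc i"] dec[of i "Suc i"] by simp
    next
      case 1
      then have "v i = u i" using bJ(2) by (simp add: v_def)
      then show ?thesis using vu[of "Suc i"] dec[of i "Suc i"] by simp
    next
      case 4
      then show ?thesis using w(3) by (auto simp: v_def)
    next
      case 5
      then show ?thesis using w(2) by (auto simp: v_def)
    next
      case 6
      then show ?thesis using dec[of i "Suc i"] by (auto simp: v_def)
    qed
  qed
  then have antiv: "antimono v" by (simp add: decseq_Suc_iff)
  have "v (length \<alpha>) = 0"
    using vu[of "length \<alpha>"] by (simp add: u_def row_def)
  then obtain \<mu> where \<mu>: "is_partition \<mu>" "row \<mu> = v"
    using ex_partition_row[OF antiv] by metis
  define S where "S = {(i, j). v i \<le> j \<and> j < u i}"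
  have S: "young_diagram \<alpha> - young_diagram \<mu> = S"
    by (simp add: S_def u_def \<mu> skew_shape_row)
  have out: "v i = u i" if "i \<notin> {a..b}" for i
    using that bJ(2) by (auto simp: v_def)
  have link: "u (Suc i) = Suc (v i)" if "a \<le> i" "i < b" for i
    using that pos[of i] by (auto simp: v_def)
  have lt: "v i < u i" if "a \<le> i" "i \<le> b" for i
    using that w(3) pos[of i] dec[of i "Suc i"] by (auto simp: v_def)
  have "v b = w" by (simp add: v_def)
  then have "card S = t"
    using sum_border_strip[of a b v u, OF bJ(2) vu link] card_skew_shape[of a b v u, OF out] w(1) a
    unfolding S_def by linarith
  moreover have "connected_boxes S"
    unfolding S_def using out link lt by (rule connected_skew_shape)
  \<comment> \<open>The diagonal corners of a block would require \<open>v i \<le> j\<close> and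
    \<open>Suc j < u (Suc i)\<close>, against \<open>u (Suc i) = Suc (v i)\<close>.\<close>
  moreover have "\<not> has_2x2_block S"
  proof
    assume "has_2x2_block S"
    then obtain i j where ij: "(i, j) \<in> S" "(Suc i, Suc j) \<in> S" unfolding has_2x2_block_def by auto
    then have "i \<in> {a..b}" "Suc i \<in> {a..b}" using out[of i] out[of "Suc i"] unfolding S_def by fastforce+
    then show False using link[of i] ij by (auto simp: S_def)
  qed
  moreover have "young_diagram \<mu> \<subseteq> young_diagram \<alpha>"
    unfolding young_diagram_subset_iff using vu by (simp add: \<mu> u_def)
  ultimately have "is_t_rim_hook t \<alpha> \<mu>"
    unfolding is_t_rim_hook_def is_rim_hook_def S using \<mu>(1) by simp
  then show ?thesis ..
qed

lemma is_t_core_iff_beads: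
  assumes "t > 0" "is_partition \<alpha>"
  shows "is_t_core t \<alpha> \<longleftrightarrow> (\<forall>z\<in>beads \<alpha>. z - int t \<in> beads \<alpha>)"
proof -
  have "(\<exists>\<mu>. is_t_rim_hook t \<alpha> \<mu>) \<longleftrightarrow> (\<exists>z\<in>beads \<alpha>. z - int t \<notin> beads \<alpha>)"
  proof
    assume "\<exists>\<mu>. is_t_rim_hook t \<alpha> \<mu>"
    then obtain \<mu> where "is_t_rim_hook t \<alpha> \<mu>" by (rule exE)
    from rim_hook_bead[OF assms this] show "\<exists>z\<in>beads \<alpha>. z - int t \<notin> beads \<alpha>" .
  next
    assume "\<exists>z\<in>beads \<alpha>. z - int t \<notin> beads \<alpha>"
    then obtain z where "z \<in> beads \<alpha>" "z - int t \<notin> beads \<alpha>" by (rule bexE)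
    from bead_rim_hook[OF assms this] show "\<exists>\<mu>. is_t_rim_hook t \<alpha> \<mu>" .
  qed
  then show ?thesis using assms(2) by (simp add: is_t_core_def)
qed

subsection \<open>The abacus\<close>

text \<open>The beads of the first \<open>r\<close> rows shifted by \<open>r - 1\<close>, which
  makes them natural numbers. Rows are read from the bottom so that the values increase with the
  index.\<close>

definition box_beads :: "nat \<Rightarrow> nat list \<Rightarrow> nat set" where
  "box_beads r \<alpha> = (\<lambda>i. row \<alpha> (r - 1 - i) + i) ` {..<r}"

text \<open>The guard \<open>t \<le> x\<close> stops at the edge of the finite window: below it
  every position carries a bead once \<open>length \<alpha> \<le> r\<close>.\<close>

definition flush :: "nat \<Rightarrow> nat set \<Rightarrow> bool" where
  "flush t X \<longleftrightarrow> (\<forall>x\<in>X. t \<le> x \<longrightarrow> x - t \<in> X)"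

lemma box_bead_less:
  assumes "is_partition \<alpha>" "i < j" "j < r"
  shows "row \<alpha> (r - 1 - i) + i < row \<alpha> (r - 1 - j) + j"
  using antimonoD[OF antimono_row[OF assms(1)], of "r - 1 - j" "r - 1 - i"] assms by linarith

lemma card_box_beads: "is_partition \<alpha> \<Longrightarrow> card (box_beads r \<alpha>) = r"
proof -
  assume p: "is_partition \<alpha>"
  have "inj_on (\<lambda>i. row \<alpha> (r - 1 - i) + i) {..<r}"
    by (rule linorder_inj_onI) (use box_bead_less[OF p] in \<open>force+\<close>)
  then show ?thesis by (simp add: box_beads_def card_image)
qed

text \<open>The beads listed by index form a strictly increasing list, which is determined by its
  set, and the rows are recovered from its entries.\<close>

lemma box_beads_inject:
  assumes "is_partition \<alpha>" "is_partition \<beta>" "length \<alpha> \<le> r" "length \<beta> \<le> r"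
    and "box_beads r \<alpha> = box_beads r \<beta>"
  shows "\<alpha> = \<beta>"
proof (rule row_inject[OF assms(1,2)])
  define f where "f \<gamma> = map (\<lambda>i. row \<gamma> (r - 1 - i) + i) [0..<r]" for \<gamma>
  have "sorted_wrt (<) (f \<gamma>)" if "is_partition \<gamma>" for \<gamma>
    using box_bead_less[OF that] by (auto simp: f_def sorted_wrt_iff_nth_less)
  then have "sorted (f \<gamma>) \<and> distinct (f \<gamma>)" if "is_partition \<gamma>" for \<gamma>
    using that by (simp add: strict_sorted_iff)
  moreover have "set (f \<gamma>) = box_beads r \<gamma>" for \<gamma>
    by (simp add: f_def box_beads_def atLeast0LessThan)
  ultimately have eq: "f \<alpha> = f \<beta>"
    using assms by (intro sorted_distinct_set_unique) simp_all
  have "row \<alpha> i = row \<beta> i" for i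
  proof (cases "i < r")
    case True
    then have "f \<alpha> ! (r - 1 - i) = f \<beta> ! (r - 1 - i)" by (simp add: eq)
    then show ?thesis using True by (simp add: f_def)
  next
    case False
    then show ?thesis using assms by (simp add: row_eq_0)
  qed
  then show "row \<alpha> = row \<beta>" by blast
qed

lemma box_beads_iff:
  assumes "is_partition \<alpha>" "length \<alpha> \<le> r"
  shows "x \<in> box_beads r \<alpha> \<longleftrightarrow> int x - (int r - 1) \<in> beads \<alpha>"
proof
  assume "x \<in> box_beads r \<alpha>"
  then obtain i where "i < r" "x = row \<alpha> (r - 1 - i) + i" by (auto simp: box_beads_def)
  then have "int x - (int r - 1) = int (row \<alpha> (r - 1 - i)) - int (r - 1 - i)" by simp
  then show "int x - (int r - 1) \<in> beads \<alpha>" unfolding beads_def by blast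
next
  assume "int x - (int r - 1) \<in> beads \<alpha>"
  then obtain i where i: "int x - (int r - 1) = int (row \<alpha> i) - int i" by (auto simp: beads_def)
  \<comment> \<open>Rows from \<open>r\<close> on are empty, so their beads are at most
    \<open>- r\<close> and would be shifted to negative positions.\<close>
  have "i < r" using i row_eq_0[of \<alpha> i] assms(2) by (cases "i < r") auto
  then have "x = row \<alpha> (r - 1 - (r - 1 - i)) + (r - 1 - i)" using i by simp
  then show "x \<in> box_beads r \<alpha>" unfolding box_beads_def
    using \<open>i < r\<close> by (intro image_eqI[where x = "r - 1 - i"]) auto
qed

lemma is_t_core_iff_flush:
  assumes "t > 0" "is_partition \<alpha>" "length \<alpha> \<le> r"
  shows "is_t_core t \<alpha> \<longleftrightarrow> flush t (box_beads r \<alpha>)"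
proof -
  \<comment> \<open>Everything from \<open>- r\<close> downwards is occupied, so closure under
    subtracting \<open>t\<close> can fail only inside the window of nonnegative shifted
    positions.\<close>
  have low: "z \<in> beads \<alpha>" if "z \<le> - int r" for z
  proof -
    have "length \<alpha> \<le> nat (- z)" using that assms(3) by linarith
    then have "z = int (row \<alpha> (nat (- z))) - int (nat (- z))"
      using row_eq_0 that by simp
    then show ?thesis unfolding beads_def by blast
  qed
  show ?thesis unfolding is_t_core_iff_beads[OF assms(1,2)] flush_def
  proof (intro iffI ballI impI)
    fix x assume h: "\<forall>z\<in>beads \<alpha>. z - int t \<in> beads \<alpha>" "x \<in> box_beads r \<alpha>" "t \<le> x"
    then have "int x - (int r - 1) - int t \<in> beads \<alpha>"
      using box_beads_iff[OF assms(2,3)] by blast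
    then show "x - t \<in> box_beads r \<alpha>"
      using h(3) by (simp add: box_beads_iff[OF assms(2,3)] algebra_simps of_nat_diff)
  next
    fix z assume h: "\<forall>x\<in>box_beads r \<alpha>. t \<le> x \<longrightarrow> x - t \<in> box_beads r \<alpha>" "z \<in> beads \<alpha>"
    show "z - int t \<in> beads \<alpha>"
    proof (cases "int t \<le> z + int r - 1")
      case True
      define x where "x = nat (z + int r - 1)"
      have x: "int x = z + int r - 1" "t \<le> x" using True by (auto simp: x_def)
      then have "x \<in> box_beads r \<alpha>" using h(2) by (simp add: box_beads_iff[OF assms(2,3)])
      then have "x - t \<in> box_beads r \<alpha>" using h(1) x(2) by blast
      then show ?thesis
        using x by (simp add: box_beads_iff[OF assms(2,3)] of_nat_diff)
    next
      case False
      then show ?thesis by (intro low) linarith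
    qed
  qed
qed

text \<open>If \<open>X\<close> is enumerated increasingly as \<open>xs\<close>, the differences
  \<open>xs ! i - i\<close> increase weakly and give the parts in reverse order. The largest is at
  most \<open>s\<close> because \<open>xs ! (r - 1) < r + s\<close>.\<close>

lemma box_beads_surj:
  assumes "X \<subseteq> {..<r + s}" "card X = r"
  obtains \<alpha> where "is_partition \<alpha>" "length \<alpha> \<le> r" "largest_part \<alpha> \<le> s" "box_beads r \<alpha> = X"
proof -
  define xs where "xs = sorted_list_of_set X"
  have fin: "finite X" using assms(1) by (rule finite_subset) simp
  have len: "length xs = r" and set: "set xs = X"
    using fin assms(2) by (simp_all add: xs_def)
  have less: "xs ! i < xs ! j" if "i < j" "j < r" for i j
    using that len strict_sorted_list_of_set[of X] unfolding xs_def[symmetric]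
    by (simp add: sorted_wrt_iff_nth_less)
  have step: "xs ! i + (j - i) \<le> xs ! j" if "i \<le> j" "j < r" for i j
    using that
  proof (induction j rule: dec_induct)
    case (step n)
    then show ?case using less[of n "Suc n"] by simp
  qed simp
  have sub: "xs ! i - i \<le> xs ! j - j" if "i \<le> j" "j < r" for i j
    using step[OF that] that by linarith
  have ge: "i \<le> xs ! i" if "i < r" for i
    using step[of 0 i] that by simp
  define f where "f j = (if j < r then xs ! (r - 1 - j) - (r - 1 - j) else 0)" for j
  have "antimono f"
  proof
    fix i j :: nat
    assume "i \<le> j"
    show "f j \<le> f i"
    proof (cases "j < r")
      case True
      then have "r - 1 - j \<le> r - 1 - i" "r - 1 - i < r" "i < r"
        using \<open>i \<le> j\<close> by simp_all
      then have "xs ! (r - 1 - j) - (r - 1 - j) \<le> xs ! (r - 1 - i) - (r - 1 - i)"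
        using sub by blast
      then show ?thesis using True \<open>i < r\<close> by (simp only: f_def if_True)
    qed (simp add: f_def)
  qed
  moreover have "f r = 0" by (simp add: f_def)
  ultimately obtain \<alpha> where \<alpha>: "is_partition \<alpha>" "row \<alpha> = f"
    by (rule ex_partition_row)
  show thesis
  proof (rule that[OF \<alpha>(1)])
    show "length \<alpha> \<le> r" using length_le_iff_row[OF \<alpha>(1)] \<alpha>(2) \<open>f r = 0\<close> by simp
    show "largest_part \<alpha> \<le> s"
    proof (cases "r = 0")
      case False
      then have "xs ! (r - 1) \<in> X" using len set nth_mem[of "r - 1" xs] by simp
      then have "xs ! (r - 1) < r + s" using assms(1) by auto
      then have "xs ! (r - 1) - (r - 1) \<le> s" using False by linarith
      moreover have "f 0 = xs ! (r - 1) - (r - 1)" using False by (simp only: f_def diff_zero) simp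
      ultimately show ?thesis by (simp only: largest_part_row \<alpha>)
    qed (simp add: largest_part_row \<alpha> f_def)
    have "row \<alpha> (r - 1 - i) + i = xs ! i" if "i < r" for i
      using that ge[of i] by (simp add: \<alpha> f_def)
    then have "box_beads r \<alpha> = (!) xs ` {..<r}" by (auto simp: box_beads_def)
    also have "\<dots> = X" using set len by (auto simp: in_set_conv_nth)
    finally show "box_beads r \<alpha> = X" .
  qed
qed

lemma box_beads_subset:
  assumes "is_partition \<alpha>" "largest_part \<alpha> \<le> s"
  shows "box_beads r \<alpha> \<subseteq> {..<r + s}"
proof -
  have "row \<alpha> i \<le> s" for i
    using antimonoD[OF antimono_row[OF assms(1)], of 0 i] assms(2) by (simp add: largest_part_row)
  then have "row \<alpha> (r - 1 - i) + i < r + s" if "i < r" for i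
    unfolding add.commute[of r s] using that by (rule add_le_less_mono)
  then show ?thesis by (auto simp: box_beads_def)
qed

lemma num_t_cores_eq_card_flush:
  assumes "t > 0"
  shows "num_t_cores t r s = card {X. X \<subseteq> {..<r + s} \<and> card X = r \<and> flush t X}"
  unfolding num_t_cores_def
proof (rule bij_betw_same_card[of "box_beads r"], unfold bij_betw_def, intro conjI)
  let ?C = "{\<alpha>. is_t_core t \<alpha> \<and> length \<alpha> \<le> r \<and> largest_part \<alpha> \<le> s}"
  let ?F = "{X. X \<subseteq> {..<r + s} \<and> card X = r \<and> flush t X}"
  have part: "is_partition \<alpha>" if "is_t_core t \<alpha>" for \<alpha> using that by (simp add: is_t_core_def)
  show "inj_on (box_beads r) ?C"
    by (intro inj_onI) (auto intro: box_beads_inject part)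
  show "box_beads r ` ?C = ?F"
  proof (intro equalityI subsetI)
    fix X assume "X \<in> box_beads r ` ?C"
    then obtain \<alpha> where "\<alpha> \<in> ?C" "X = box_beads r \<alpha>" by blast
    then show "X \<in> ?F"
      using box_beads_subset[of \<alpha> s r] card_box_beads[of \<alpha> r] part[of \<alpha>]
        is_t_core_iff_flush[OF assms, of \<alpha> r] by simp
  next
    fix X assume "X \<in> ?F"
    then obtain \<alpha> where "is_partition \<alpha>" "length \<alpha> \<le> r" "largest_part \<alpha> \<le> s" "box_beads r \<alpha> = X"
      "flush t X"
      using box_beads_surj[of X r s] by blast
    then show "X \<in> box_beads r ` ?C"
      using is_t_core_iff_flush[OF assms, of \<alpha> r] by blast
  qed
qed

section \<open>Bead counts on the runners\<close>

text \<open>Position \<open>x\<close> sits on runner \<open>x mod t\<close> at height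
  \<open>x div t\<close>; runner \<open>i\<close> carries \<open>ns ! i\<close> beads pushed to the
  bottom.\<close>

definition abacus :: "nat \<Rightarrow> nat list \<Rightarrow> nat set" where
  "abacus t ns = {x. x div t < ns ! (x mod t)}"

lemma abacus_iff: "i < t \<Longrightarrow> t * k + i \<in> abacus t ns \<longleftrightarrow> k < ns ! i"
  by (simp add: abacus_def)

lemma card_abacus:
  assumes "t > 0" "length ns = t"
  shows "card (abacus t ns) = sum_list ns"
proof -
  have "bij_betw (\<lambda>(i, k). t * k + i) (Sigma {..<t} (\<lambda>i. {..<ns ! i})) (abacus t ns)"
    by (rule bij_betw_byWitness[where f' = "\<lambda>x. (x mod t, x div t)"])
      (use assms in \<open>auto simp: abacus_def\<close>)
  from bij_betw_same_card[OF this] show ?thesis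
    using assms by (simp add: sum_list_sum_nth atLeast0LessThan)
qed

lemma flush_abacus: "t > 0 \<Longrightarrow> flush t (abacus t ns)"
  by (auto simp: flush_def abacus_def le_div_geq le_mod_geq)

lemma abacus_inject:
  assumes "length ns = t" "length ms = t" "abacus t ns = abacus t ms"
  shows "ns = ms"
proof (rule nth_equalityI)
  show "ns ! i = ms ! i" if "i < length ns" for i
  proof -
    have "k < ns ! i \<longleftrightarrow> k < ms ! i" for k
      using abacus_iff[of i t k ns] abacus_iff[of i t k ms] assms that by simp
    from this[of "ns ! i"] this[of "ms ! i"] show ?thesis by simp
  qed
qed (use assms in simp)

text \<open>On each runner the occupied heights form a finite set closed under predecessor, hence an
  initial segment whose length is its cardinality.\<close>

lemma flush_eq_abacus:
  assumes "t > 0" "finite X" "flush t X"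
  obtains ns where "length ns = t" "abacus t ns = X"
proof
  define n where "n i = card {k. t * k + i \<in> X}" for i
  have n: "t * k + i \<in> X \<longleftrightarrow> k < n i" for i k
  proof -
    let ?K = "{k. t * k + i \<in> X}"
    have "inj_on (\<lambda>k. t * k + i) ?K" using assms(1) by (auto intro: inj_onI)
    moreover have "(\<lambda>k. t * k + i) ` ?K \<subseteq> X" by auto
    ultimately have fin: "finite ?K" using assms(2) by (rule inj_on_finite)
    have pred: "k \<in> ?K" if "Suc k \<in> ?K" for k
      using assms(3) that by (auto simp: flush_def)
    have down: "k \<in> ?K \<longrightarrow> j \<in> ?K" if "j \<le> k" for j k
      using that by (induction k rule: dec_induct) (use pred in blast)+
    show ?thesis
    proof
      assume "t * k + i \<in> X"
      then have "{..k} \<subseteq> ?K" using down by auto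
      from card_mono[OF fin this] show "k < n i" by (simp add: n_def)
    next
      assume "k < n i"
      show "t * k + i \<in> X"
      proof (rule ccontr)
        assume "t * k + i \<notin> X"
        then have "?K \<subseteq> {..<k}" using down[of k] by (auto simp flip: not_le)
        from card_mono[OF _ this] show False using \<open>k < n i\<close> by (simp add: n_def)
      qed
    qed
  qed
  show "length (map n [0..<t]) = t" by simp
  have "x \<in> abacus t (map n [0..<t]) \<longleftrightarrow> x \<in> X" for x
    using n[of "x div t" "x mod t"] assms(1) by (simp add: abacus_def)
  then show "abacus t (map n [0..<t]) = X" by blast
qed

text \<open>Zero entries are allowed, since a runner may be empty. The strict bound makes the
  generating function a power of \<open>1 + X + ... + X^(m-1)\<close>.\<close>

definition bounded_compositions :: "nat \<Rightarrow> nat \<Rightarrow> nat \<Rightarrow> nat list set" where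
  "bounded_compositions t n m = {ns. length ns = t \<and> sum_list ns = n \<and> set ns \<subseteq> {..<m}}"

lemma finite_bounded_compositions: "finite (bounded_compositions t n m)"
  by (rule finite_subset[OF _ finite_lists_length_eq[of "{..<m}" t]])
    (auto simp: bounded_compositions_def)

lemma abacus_subset:
  assumes "t > 0" "length ns = t" "set ns \<subseteq> {..<Suc (M div t)}"
  shows "abacus t ns \<subseteq> {..<M}"
proof
  fix x assume x: "x \<in> abacus t ns"
  have "ns ! (x mod t) \<in> set ns" using assms by simp
  then have "x div t < M div t" using x assms(3) by (auto simp: abacus_def)
  then show "x \<in> {..<M}" using div_le_mono[of M x t] by (cases "x < M") auto
qed

lemma abacus_bound:
  assumes "t > 0" "length ns = t" "abacus t ns \<subseteq> {..<M}"
  shows "set ns \<subseteq> {..<Suc (Suc (M div t))}"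
proof
  fix n assume "n \<in> set ns"
  then obtain i where i: "i < t" "n = ns ! i" using assms(2) by (auto simp: in_set_conv_nth)
  show "n \<in> {..<Suc (Suc (M div t))}"
  proof (cases n)
    case (Suc k)
    then have "t * k + i \<in> abacus t ns" using i by (simp add: abacus_iff)
    then have "t * k + i < M" using assms(3) by auto
    then have "(t * k + i) div t \<le> M div t" by (intro div_le_mono) simp
    then show ?thesis using Suc i by simp
  qed simp
qed

text \<open>A runner has \<open>(r + s) div t\<close> or one more positions inside the window,
  depending on its residue. Replacing these capacities by a uniform one gives a lower and an upper
  bound with the same asymptotics.\<close>

lemma num_t_cores_bounds:
  assumes "t > 0"
  shows "card (bounded_compositions t r (Suc ((r + s) div t))) \<le> num_t_cores t r s"
    and "num_t_cores t r s \<le> card (bounded_compositions t r (Suc (Suc ((r + s) div t))))"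
proof -
  let ?F = "{X. X \<subseteq> {..<r + s} \<and> card X = r \<and> flush t X}"
  let ?L = "bounded_compositions t r (Suc ((r + s) div t))"
  let ?U = "bounded_compositions t r (Suc (Suc ((r + s) div t)))"
  have finF: "finite ?F" by (rule finite_subset[of _ "Pow {..<r + s}"]) auto
  have "inj_on (abacus t) ?L"
    by (intro inj_onI) (auto simp: bounded_compositions_def intro: abacus_inject)
  moreover have "abacus t ` ?L \<subseteq> ?F"
    using assms card_abacus[OF assms] abacus_subset[OF assms, of _ "r + s"] flush_abacus[OF assms]
    by (auto simp: bounded_compositions_def)
  ultimately show "card ?L \<le> num_t_cores t r s"
    unfolding num_t_cores_eq_card_flush[OF assms] using finF by (rule card_inj_on_le)
  have "?F \<subseteq> abacus t ` ?U"
  proof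
    fix X assume X: "X \<in> ?F"
    then have "finite X" using finite_subset[of X "{..<r + s}"] by simp
    then obtain ns where "length ns = t" "abacus t ns = X"
      using flush_eq_abacus[OF assms] X by blast
    moreover from this have "ns \<in> ?U"
      using X card_abacus[OF assms, of ns] abacus_bound[OF assms, of ns "r + s"]
      by (simp add: bounded_compositions_def)
    ultimately show "X \<in> abacus t ` ?U" by blast
  qed
  then show "num_t_cores t r s \<le> card ?U"
    unfolding num_t_cores_eq_card_flush[OF assms]
    by (rule surj_card_le[OF finite_bounded_compositions])
qed

subsection \<open>Counting bounded compositions\<close>

lemma card_bounded_compositions_Suc:
  "card (bounded_compositions (Suc t) n m) =
     (\<Sum>i=0..n. if i < m then card (bounded_compositions t (n - i) m) else 0)"
proof -
  \<comment> \<open>Splitting off the first entry \<open>i\<close> yields the convolution that also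
    describes the coefficients of a product of power series.\<close>
  let ?I = "{i. i \<le> n \<and> i < m}"
  have "bounded_compositions (Suc t) n m = (\<Union>i\<in>?I. (#) i ` bounded_compositions t (n - i) m)"
    (is "_ = ?U")
  proof (intro equalityI subsetI)
    fix ns assume ns: "ns \<in> bounded_compositions (Suc t) n m"
    then obtain i js where "ns = i # js" by (cases ns) (auto simp: bounded_compositions_def)
    moreover from this have "i \<in> ?I" "js \<in> bounded_compositions t (n - i) m"
      using ns by (auto simp: bounded_compositions_def)
    ultimately show "ns \<in> ?U" by blast
  qed (auto simp: bounded_compositions_def)
  also have "card \<dots> = (\<Sum>i\<in>?I. card ((#) i ` bounded_compositions t (n - i) m))"
    by (rule card_UN_disjoint) (auto simp: finite_bounded_compositions)
  also have "\<dots> = (\<Sum>i\<in>?I. card (bounded_compositions t (n - i) m))"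
    by (simp add: card_image)
  also have "?I = {0..n} \<inter> {i. i < m}" by auto
  finally show ?thesis by (simp add: sum.inter_restrict)
qed

lemma fps_nth_power_bounded_compositions:
  "fps_nth (Abs_fps (\<lambda>i. if i < m then 1 else 0) ^ t :: real fps) n =
     real (card (bounded_compositions t n m))"
proof (induction t arbitrary: n)
  case 0
  have "bounded_compositions 0 n m = (if n = 0 then {[]} else {})"
    by (auto simp: bounded_compositions_def)
  then show ?case by simp
next
  case (Suc t)
  show ?case
    by (auto simp: fps_mult_nth Suc card_bounded_compositions_Suc intro!: sum.cong)
qed

lemma Abs_fps_less_eq:
  "Abs_fps (\<lambda>i. if i < m then 1 else 0) = (1 - fps_X ^ m) * inverse (1 - fps_X :: real fps)"
  by (rule fps_ext)
    (simp add: fps_inverse_one_minus_fps_X left_diff_distrib fps_X_power_mult_nth)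

text \<open>Inclusion-exclusion over the entries that are at least \<open>m\<close>, obtained by
  expanding \<open>(1 - X^m)^t\<close> binomially and multiplying by \<open>(1 - X)^(-t)\<close>,
  whose coefficients count unrestricted weak compositions. The factor \<open>X^(j*m)\<close>
  contributes only if \<open>j * m \<le> n\<close>.\<close>

lemma card_bounded_compositions:
  assumes "t > 0"
  shows "real (card (bounded_compositions t n m)) =
    (\<Sum>j\<le>t. (- 1) ^ j * real (t choose j) *
       (if j * m \<le> n then real ((t + (n - j * m) - 1) choose (n - j * m)) else 0))"
proof -
  define h where "h = (inverse ((1 - fps_X) ^ t) :: real fps)"
  have h: "h = Abs_fps (\<lambda>k. real ((t + k - 1) choose k))"
    using one_minus_const_fps_X_neg_power'[OF assms, of "1 :: real"] by (simp add: h_def)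
  have "(1 - fps_X ^ m :: real fps) ^ t = (- (fps_X ^ m) + 1) ^ t" by simp
  also have "\<dots> = (\<Sum>j\<le>t. of_nat (t choose j) * (- (fps_X ^ m)) ^ j)"
    by (subst binomial_ring) simp
  also have "\<dots> = (\<Sum>j\<le>t. fps_const ((- 1) ^ j * real (t choose j)) * fps_X ^ (j * m))"
    by (intro sum.cong refl, subst power_minus)
      (simp add: fps_of_nat[symmetric] fps_const_power[symmetric] fps_const_neg[symmetric]
        power_mult[symmetric] mult_ac
        del: fps_const_power fps_const_neg fps_const_mult
        flip: fps_const_mult)
  finally have b: "(1 - fps_X ^ m :: real fps) ^ t =
    (\<Sum>j\<le>t. fps_const ((- 1) ^ j * real (t choose j)) * fps_X ^ (j * m))" .
  have "real (card (bounded_compositions t n m)) =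
    fps_nth ((\<Sum>j\<le>t. fps_const ((- 1) ^ j * real (t choose j)) * fps_X ^ (j * m)) * h) n"
    unfolding fps_nth_power_bounded_compositions[symmetric] Abs_fps_less_eq b[symmetric] h_def
    by (simp add: power_mult_distrib fps_inverse_power)
  also have "\<dots> = (\<Sum>j\<le>t. (- 1) ^ j * real (t choose j) *
       (if j * m \<le> n then real ((t + (n - j * m) - 1) choose (n - j * m)) else 0))"
    unfolding sum_distrib_right fps_sum_nth mult.assoc fps_mult_left_const_nth fps_X_power_mult_nth
    by (intro sum.cong refl) (auto simp: h)
  finally show ?thesis .
qed

section \<open>Asymptotics\<close>

text \<open>The binomial coefficient is \<open>(n + 1) ... (n + t - 1) / (t - 1)!\<close>, and each
  of its \<open>t - 1\<close> factors lies between \<open>n\<close> and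
  \<open>n + t\<close>.\<close>

lemma multichoose_bounds:
  assumes "t > 0"
  shows "real n ^ (t - 1) / fact (t - 1) \<le> real ((t + n - 1) choose n)"
    and "real ((t + n - 1) choose n) \<le> (real n + real t) ^ (t - 1) / fact (t - 1)"
proof -
  have "(t + n - 1) choose n = (t + n - 1) choose (t - 1)"
    using assms by (subst binomial_symmetric) auto
  then have "real ((t + n - 1) choose n) = real (t + n - 1) gchoose (t - 1)"
    by (simp add: binomial_gbinomial)
  also have "\<dots> = (\<Prod>i<t - 1. real n + 1 + real i) / fact (t - 1)"
    using assms by (simp add: gbinomial_pochhammer' pochhammer_prod of_nat_diff atLeast0LessThan)
  finally have eq: "real ((t + n - 1) choose n) = (\<Prod>i<t - 1. real n + 1 + real i) / fact (t - 1)" .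
  have "(\<Prod>i<t - 1. real n) \<le> (\<Prod>i<t - 1. real n + 1 + real i)"
    by (intro prod_mono) auto
  then show "real n ^ (t - 1) / fact (t - 1) \<le> real ((t + n - 1) choose n)"
    unfolding eq by (intro divide_right_mono) simp_all
  have "(\<Prod>i<t - 1. real n + 1 + real i) \<le> (\<Prod>i<t - 1. real n + real t)"
    by (intro prod_mono) auto
  then show "real ((t + n - 1) choose n) \<le> (real n + real t) ^ (t - 1) / fact (t - 1)"
    unfolding eq by (intro divide_right_mono) simp_all
qed

lemma multichoose_limit:
  fixes r m :: "nat \<Rightarrow> nat"
  assumes "t \<ge> 2" "filterlim r at_top sequentially"
    and "(\<lambda>k. real (m k) / real (r k)) \<longlonglongrightarrow> c"
  shows "(\<lambda>k. (if j * m k \<le> r k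
                then real ((t + (r k - j * m k) - 1) choose (r k - j * m k)) else 0)
              / real (r k) ^ (t - 1))
     \<longlonglongrightarrow> max 0 (1 - real j * c) ^ (t - 1) / fact (t - 1)"
proof -
  \<comment> \<open>The scaled argument \<open>(r - j * m) / r\<close>, clipped at zero to match the
    \<open>if\<close>. Clipping is continuous, so the borderline \<open>j * c = 1\<close> needs no
    separate case.\<close>
  define y where "y k = max 0 (1 - real j * (real (m k) / real (r k)))" for k
  have y: "y \<longlonglongrightarrow> max 0 (1 - real j * c)"
    unfolding y_def by (intro tendsto_intros assms)
  have rr: "filterlim (\<lambda>k. real (r k)) at_top sequentially"
    by (rule filterlim_compose[OF filterlim_real_sequentially assms(2)])
  have z: "(\<lambda>k. real t / real (r k)) \<longlonglongrightarrow> 0"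
    by (rule tendsto_divide_0[OF tendsto_const filterlim_at_top_imp_at_infinity[OF rr]])
  have pos: "\<forall>\<^sub>F k in sequentially. r k > 0"
    using assms(2)[unfolded filterlim_at_top, rule_format, of 1] by (simp add: Suc_le_eq)
  have scale: "y k = real (r k - j * m k) / real (r k)" if "j * m k \<le> r k" "r k > 0" for k
  proof -
    have "real j * real (m k) \<le> real (r k)" using that(1) by (metis of_nat_le_iff of_nat_mult)
    moreover have "real (r k - j * m k) = real (r k) - real j * real (m k)"
      using that(1) by (simp add: of_nat_diff)
    ultimately show ?thesis using that(2) by (simp add: y_def max_def field_simps)
  qed
  have y0: "y k = 0" if "\<not> j * m k \<le> r k" "r k > 0" for k
  proof -
    have "real (r k) \<le> real j * real (m k)"
      using that by (metis nat_le_linear of_nat_le_iff of_nat_mult)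
    then show ?thesis using that(2) by (simp add: y_def field_simps)
  qed
  show ?thesis
  proof (rule tendsto_sandwich[OF _ _ tendsto_divide[OF tendsto_power[OF y] tendsto_const]])
    show "\<forall>\<^sub>F k in sequentially. y k ^ (t - 1) / fact (t - 1) \<le>
      (if j * m k \<le> r k
        then real ((t + (r k - j * m k) - 1) choose (r k - j * m k)) else 0) / real (r k) ^ (t - 1)"
      using pos
    proof eventually_elim
      case (elim k)
      show ?case
      proof (cases "j * m k \<le> r k")
        case True
        show ?thesis
          using divide_right_mono[OF multichoose_bounds(1)[of t "r k - j * m k"],
              of "real (r k) ^ (t - 1)"] True assms(1) scale[OF True elim]
          by (simp add: power_divide mult.commute)
      next
        case False
        \<comment> \<open>The exponent \<open>t - 1\<close> is positive, so the lower bound is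
          \<open>0\<close>.\<close>
        then show ?thesis using y0[OF False elim] assms(1) by (simp add: power_0_left)
      qed
    qed
    show "\<forall>\<^sub>F k in sequentially. (if j * m k \<le> r k
        then real ((t + (r k - j * m k) - 1) choose (r k - j * m k)) else 0) / real (r k) ^ (t - 1)
      \<le> (y k + real t / real (r k)) ^ (t - 1) / fact (t - 1)"
      using pos
    proof eventually_elim
      case (elim k)
      show ?case
      proof (cases "j * m k \<le> r k")
        case True
        have "y k + real t / real (r k) = (real (r k - j * m k) + real t) / real (r k)"
          by (simp add: scale[OF True elim] add_divide_distrib)
        then show ?thesis
          using divide_right_mono[OF multichoose_bounds(2)[of t "r k - j * m k"],
              of "real (r k) ^ (t - 1)"] True assms(1)
          by (simp add: power_divide mult.commute)
      next
        case False
        then show ?thesis by (simp add: y_def)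
      qed
    qed
    show "(\<lambda>k. (y k + real t / real (r k)) ^ (t - 1) / fact (t - 1))
      \<longlonglongrightarrow> max 0 (1 - real j * c) ^ (t - 1) / fact (t - 1)"
      using tendsto_divide[OF tendsto_power[OF tendsto_add[OF y z]] tendsto_const] by simp
  qed simp
qed

lemma bounded_compositions_limit:
  fixes r m :: "nat \<Rightarrow> nat"
  assumes "t \<ge> 2" "filterlim r at_top sequentially"
    and "(\<lambda>k. real (m k) / real (r k)) \<longlonglongrightarrow> c"
  shows "(\<lambda>k. real (card (bounded_compositions t (r k) (m k))) / real (r k) ^ (t - 1))
     \<longlonglongrightarrow> (\<Sum>j\<le>t. (- 1) ^ j * real (t choose j) *
           (max 0 (1 - real j * c) ^ (t - 1) / fact (t - 1)))"
proof -
  have "t > 0" using assms(1) by simp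
  show ?thesis
    unfolding card_bounded_compositions[OF \<open>t > 0\<close>] sum_divide_distrib times_divide_eq_right[symmetric]
    by (intro tendsto_sum tendsto_mult tendsto_const multichoose_limit assms)
qed

text \<open>The floor in \<open>limit_A\<close> cuts the sum exactly where
  \<open>t - (1 + \<kappa>) * j\<close> turns negative. Clipping at zero therefore extends it to all
  \<open>j \<le> t\<close>, and dividing by \<open>t^(t - 1)\<close> scales the clipped base by
  \<open>1 / t\<close>.\<close>

lemma limit_A_eq:
  assumes "t \<ge> 2" "\<kappa> \<ge> 1"
  shows "limit_A t \<kappa> / real t ^ (t - 1) =
    (\<Sum>j\<le>t. (- 1) ^ j * real (t choose j) *
      (max 0 (1 - real j * ((1 + \<kappa>) / real t)) ^ (t - 1) / fact (t - 1)))"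
proof -
  let ?g = "\<lambda>j. (- 1) ^ j * real (t choose j) * max 0 (real t - (1 + \<kappa>) * real j) ^ (t - 1)"
  let ?J = "{0..nat \<lfloor>real t / (\<kappa> + 1)\<rfloor>}"
  have le: "j \<in> ?J \<longleftrightarrow> 0 \<le> real t - (1 + \<kappa>) * real j" for j
  proof -
    have "j \<in> ?J \<longleftrightarrow> real j \<le> real t / (\<kappa> + 1)"
      using assms by (simp add: le_nat_iff le_floor_iff)
    also have "\<dots> \<longleftrightarrow> 0 \<le> real t - (1 + \<kappa>) * real j"
      using assms by (simp add: field_simps)
    finally show ?thesis .
  qed
  have J: "?J \<subseteq> {..t}"
  proof
    fix j assume "j \<in> ?J"
    then have "(1 + \<kappa>) * real j \<le> real t" using le by simp
    moreover have "1 * real j \<le> (1 + \<kappa>) * real j" using assms by (intro mult_right_mono) auto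
    ultimately show "j \<in> {..t}" by simp
  qed
  have scale: "max 0 (1 - real j * ((1 + \<kappa>) / real t)) = max 0 (real t - (1 + \<kappa>) * real j) / real t" for j
    using assms by (simp add: max_def field_simps)
  have "(\<Sum>j\<in>?J. (-1) ^ j * real (t choose j) * (real t - (1 + \<kappa>) * real j) ^ (t - 1)) = sum ?g ?J"
    by (intro sum.cong refl) (use le in \<open>simp add: max_def\<close>)
  \<comment> \<open>The added terms have clipped base \<open>0\<close> and positive exponent
    \<open>t - 1\<close>.\<close>
  also have "\<dots> = sum ?g {..t}"
  proof (rule sum.mono_neutral_left[OF _ J])
    show "\<forall>j\<in>{..t} - ?J. ?g j = 0"
    proof
      fix j assume "j \<in> {..t} - ?J"
      then have "max 0 (real t - (1 + \<kappa>) * real j) = 0" using le[of j] by auto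
      then show "?g j = 0" using assms(1) by simp
    qed
  qed simp
  finally have "limit_A t \<kappa> = sum ?g {..t} / fact (t - 1)" by (simp add: limit_A_def)
  then show ?thesis
    unfolding scale power_divide sum_divide_distrib
    by (simp add: sum_divide_distrib mult_ac)
qed

text \<open>Rounding down costs less than one and the offset \<open>a\<close> is constant, so both
  vanish after division by \<open>r k\<close>. The free offset serves both uniform capacities at
  once.\<close>

lemma div_limit:
  fixes r s :: "nat \<Rightarrow> nat"
  assumes "t > 0" "filterlim r at_top sequentially"
    and "(\<lambda>k. real (s k) / real (r k)) \<longlonglongrightarrow> \<kappa>"
  shows "(\<lambda>k. real ((r k + s k) div t + a) / real (r k)) \<longlonglongrightarrow> (1 + \<kappa>) / real t"
proof (rule tendsto_sandwich)
  let ?q = "\<lambda>k. (r k + s k) div t"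
  have rr: "filterlim (\<lambda>k. real (r k)) at_top sequentially"
    by (rule filterlim_compose[OF filterlim_real_sequentially assms(2)])
  have z: "(\<lambda>k. b / real (r k)) \<longlonglongrightarrow> 0" for b
    by (rule tendsto_divide_0[OF tendsto_const filterlim_at_top_imp_at_infinity[OF rr]])
  have lim: "(\<lambda>k. (1 + real (s k) / real (r k)) / real t + b / real (r k))
      \<longlonglongrightarrow> (1 + \<kappa>) / real t" for b
    using tendsto_add[OF tendsto_divide[OF tendsto_add[OF tendsto_const[of 1] assms(3)]
          tendsto_const[of "real t"]] z[of b]] assms(1) by simp
  show "(\<lambda>k. (1 + real (s k) / real (r k)) / real t + (real a - 1) / real (r k))
      \<longlonglongrightarrow> (1 + \<kappa>) / real t" by (rule lim)
  show "(\<lambda>k. (1 + real (s k) / real (r k)) / real t + real a / real (r k))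
      \<longlonglongrightarrow> (1 + \<kappa>) / real t" by (rule lim)
  have pos: "\<forall>\<^sub>F k in sequentially. r k > 0"
    using assms(2)[unfolded filterlim_at_top, rule_format, of 1] by (simp add: Suc_le_eq)
  have split: "(1 + real (s k) / real (r k)) / real t + b / real (r k) =
      (real (r k + s k) / real t + b) / real (r k)" if "r k > 0" for k b
    using that assms(1) by (simp add: field_simps)
  have q: "real (?q k) \<le> real (r k + s k) / real t"
    "real (r k + s k) / real t - 1 \<le> real (?q k)" for k
    using floor_divide_of_nat_eq[of "r k + s k" t, where ?'a = real] by linarith+
  show "\<forall>\<^sub>F k in sequentially. (1 + real (s k) / real (r k)) / real t + (real a - 1) / real (r k)
      \<le> real (?q k + a) / real (r k)"
    using pos by eventually_elim (subst split, simp, rule divide_right_mono, use q in \<open>simp add: algebra_simps\<close>, simp)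
  show "\<forall>\<^sub>F k in sequentially. real (?q k + a) / real (r k)
      \<le> (1 + real (s k) / real (r k)) / real t + real a / real (r k)"
    using pos by eventually_elim (subst split, simp, rule divide_right_mono, use q in \<open>simp add: algebra_simps\<close>, simp)
qed

theorem theorem3p9:
  fixes t :: nat and \<kappa> :: real and r s :: "nat \<Rightarrow> nat"
  assumes "t \<ge> 2" and "\<kappa> \<ge> 1"
    and "\<And>k. r k > 0" and "\<And>k. s k > 0"
    and "filterlim r at_top sequentially"
    and "filterlim s at_top sequentially"
    and "(\<lambda>k. real (s k) / real (r k)) \<longlonglongrightarrow> \<kappa>"
  shows "(\<lambda>k. real (num_t_cores t (r k) (s k)) / real (r k) ^ (t - 1))
           \<longlonglongrightarrow> limit_A t \<kappa> / real t ^ (t - 1)"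
proof -
  have t: "t > 0" using assms(1) by simp
  have lim: "(\<lambda>k. real (card (bounded_compositions t (r k) ((r k + s k) div t + a))) / real (r k) ^ (t - 1))
      \<longlonglongrightarrow> limit_A t \<kappa> / real t ^ (t - 1)" for a
    unfolding limit_A_eq[OF assms(1,2)]
    by (rule bounded_compositions_limit[OF assms(1,5) div_limit[OF t assms(5,7)]])
  show ?thesis
    \<comment> \<open>Offsets \<open>1\<close> and \<open>2\<close> are the strict bounds
      \<open>Suc\<close> and \<open>Suc (Suc ...)\<close> from
      \<open>num_t_cores_bounds\<close>.\<close>
    by (rule tendsto_sandwich[OF _ _ lim[of 1] lim[of 2]])
      (use num_t_cores_bounds[OF t] in \<open>auto intro!: always_eventually divide_right_mono\<close>)
qed

end
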